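(* Let $h=(H,H_1,\dots,H_m)\in G=\mathrm{PGL}_4\times\mathrm{PGL}_3^m$ and let $\mathcal{C}=(C_1,\dots,C_m)$ be a camera arrangement. Then $$\mathcal{L}_{h\cdot\mathcal{C}}=L_h(\mathcal{L}_{\mathcal{C}}),$$ or equivalently $$I(\mathcal{L}_{h\cdot\mathcal{C}})=L_h^{-1}(I(\mathcal{L}_{\mathcal{C}})).$$
   Context: A camera is a matrix $C\in\mathbb{C}^{3\times4}$ of rank $3$ with center $\ker C\in\mathbb{P}^3$. A camera arrangement is a tuple $\mathcal{C}=(C_1,\dots,C_m)$ of $m\ge2$ cameras with pairwise distinct centers (standing assumption). Let $\mathbb{G}$ be the Grassmannian of lines in $\mathbb{P}^3$. The joint camera map $\Upsilon_{\mathcal{C}}:\mathbb{G}\dashrightarrow(\mathbb{P}^2)^m$ sends a line $L$ containing no center and spanned by $a,b$ to $(\ell_1,\dots,\ell_m)$, where $\ell_i=(C_ia)\times(C_ib)$ is the linear equation of the image line $C_i\cdot L$. The line multiview variety is the Zariski closure $\mathcal{L}_{\mathcal{C}}=\overline{\Upsilon_{\mathcal{C}}(\mathbb{G})}$, and $I(\mathcal{L}_{\mathcal{C}})\subseteq\mathbb{C}[\ell]=\mathbb{C}[\ell_{i,j}\mid1\le i\le3,1\le j\le m]$ is the (multihomogeneous) ideal of all polynomials vanishing on $\mathcal{L}_{\mathcal{C}}$; write $\ell_k=(\ell_{1,k},\ell_{2,k},\ell_{3,k})^T$. The group $G=\mathrm{PGL}_4\times\mathrm{PGL}_3^m$ (over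 $\mathbb{C}$) acts on camera arrangements by $(H,H_1,\dots,H_m)\cdot(C_1,\dots,C_m)=(H_1C_1H^{-1},\dots,H_mC_mH^{-1})$ (camera matrices taken up to scale, matrix representatives being chosen). $L_h:\mathbb{C}[\ell]\to\mathbb{C}[\ell]$ is the ring isomorphism $\ell_i\mapsto H_i^{-T}\ell_i$; it is identified with the map $(\mathbb{P}^2)^m\to(\mathbb{P}^2)^m$ sending $(\ell_i)_i$ to $(H_i^{-T}\ell_i)_i$. $L_h^{-1}(I)$ denotes the preimage of the ideal $I$ under the ring map. *)

theory Defs
  imports "HOL-Analysis.Analysis" "HOL-Library.Poly_Mapping"
begin

section \<open>Projective space and lines\<close>

text \<open>
  Points of a projective space are the one-dimensional linear subspaces of
  \<open>complex ^ 'n\<close>, and lines are the two-dimensional ones, so that incidence is inclusion.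
\<close>

definition proj_pt :: "complex ^ 'n \<Rightarrow> (complex ^ 'n) set" where
  "proj_pt v = vec.span {v}"

definition proj_space :: "(complex ^ 'n) set set" where
  "proj_space = {P. vec.subspace P \<and> vec.dim P = 1}"

definition lines_P3 :: "(complex ^ 4) set set" where
  "lines_P3 = {L. vec.subspace L \<and> vec.dim L = 2}"

section \<open>Cameras and the joint camera map\<close>

definition camera :: "complex ^ 4 ^ 3 \<Rightarrow> bool" where
  "camera A \<longleftrightarrow> rank A = 3"

definition center :: "complex ^ 4 ^ 3 \<Rightarrow> (complex ^ 4) set" where
  "center A = {x. A *v x = 0}"

text \<open>The type \<open>'m\<close> is the index set of the cameras.\<close>

definition camera_arrangement :: "('m::finite \<Rightarrow> complex ^ 4 ^ 3) \<Rightarrow> bool" where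
  "camera_arrangement C \<longleftrightarrow>
     CARD('m) \<ge> 2 \<and> (\<forall>i. camera (C i)) \<and> inj (\<lambda>i. center (C i))"

text \<open>The bilinear cross product over the complex numbers; \<open>cross3\<close> is only available for reals.\<close>

definition ccross :: "complex ^ 3 \<Rightarrow> complex ^ 3 \<Rightarrow> complex ^ 3" where
  "ccross a b = vector [a$2 * b$3 - a$3 * b$2, a$3 * b$1 - a$1 * b$3, a$1 * b$2 - a$2 * b$1]"

definition joint_camera_domain :: "('m::finite \<Rightarrow> complex ^ 4 ^ 3) \<Rightarrow> (complex ^ 4) set set" where
  "joint_camera_domain C = {L \<in> lines_P3. \<forall>i. \<not> center (C i) \<subseteq> L}"

text \<open>
  Points of the \<open>m\<close>-fold product of the projective plane are functions
  \<open>'m \<Rightarrow> (complex ^ 3) set\<close> with values in \<open>proj_space\<close>. The value of the camera map does not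
  depend on the spanning pair, see \<open>joint_camera_map_eq\<close>.
\<close>

definition joint_camera_map ::
    "('m::finite \<Rightarrow> complex ^ 4 ^ 3) \<Rightarrow> (complex ^ 4) set \<Rightarrow> 'm \<Rightarrow> (complex ^ 3) set" where
  "joint_camera_map C L =
     (THE l. \<exists>a b. L = vec.span {a, b} \<and> l = (\<lambda>i. proj_pt (ccross (C i *v a) (C i *v b))))"

lemma ccross_combination:
  "ccross (p *s u + q *s v) (r *s u + s *s v) = (p * s - q * r) *s ccross u v"
  by (simp add: ccross_def vec_eq_iff forall_3 algebra_simps)

lemma proj_pt_ccross_subset:
  assumes "vec.span {a, b} = vec.span {a', b'}"
  shows "proj_pt (ccross (A *v a') (A *v b')) \<subseteq> proj_pt (ccross (A *v a) (A *v b))"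
proof -
  have "a' \<in> vec.span {a, b}" "b' \<in> vec.span {a, b}"
    using assms by (auto intro: vec.span_base)
  moreover have "\<exists>p q. x = p *s a + q *s b" if x: "x \<in> vec.span {a, b}" for x
  proof -
    obtain p where "x - p *s a \<in> vec.span {b}" using x vec.span_breakdown_eq[of x a "{b}"] by blast
    then obtain q where "x - p *s a = q *s b" by (auto simp: vec.span_singleton)
    then show ?thesis by (metis add.commute diff_add_cancel)
  qed
  ultimately obtain p q r s where a': "a' = p *s a + q *s b" and b': "b' = r *s a + s *s b"
    by meson
  have "ccross (A *v a') (A *v b') = (p * s - q * r) *s ccross (A *v a) (A *v b)"
    unfolding a' b' by (simp only: ccross_combination matrix_vector_right_distrib vector_scalar_commute)
  then have "ccross (A *v a') (A *v b') \<in> vec.span {ccross (A *v a) (A *v b)}"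
    by (simp only: vec.span_singleton) (rule rangeI)
  then have "{ccross (A *v a') (A *v b')} \<subseteq> vec.span {ccross (A *v a) (A *v b)}"
    by (rule insert_subsetI[OF _ empty_subsetI])
  then show ?thesis
    unfolding proj_pt_def by (rule vec.span_minimal[OF _ vec.subspace_span])
qed

lemma joint_camera_map_eq:
  assumes "L = vec.span {a, b}"
  shows "joint_camera_map C L = (\<lambda>i. proj_pt (ccross (C i *v a) (C i *v b)))"
  unfolding joint_camera_map_def
proof (rule the_equality)
  show "\<exists>a' b'. L = vec.span {a', b'} \<and>
      (\<lambda>i. proj_pt (ccross (C i *v a) (C i *v b))) = (\<lambda>i. proj_pt (ccross (C i *v a') (C i *v b')))"
    using assms by blast
next
  fix l assume "\<exists>a' b'. L = vec.span {a', b'} \<and> l = (\<lambda>i. proj_pt (ccross (C i *v a') (C i *v b')))"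
  then obtain a' b' where L: "L = vec.span {a', b'}"
    and l: "l = (\<lambda>i. proj_pt (ccross (C i *v a') (C i *v b')))"
    by blast
  have span: "vec.span {a, b} = vec.span {a', b'}"
    by (rule trans[OF assms[symmetric] L])
  show "l = (\<lambda>i. proj_pt (ccross (C i *v a) (C i *v b)))"
    unfolding l
    by (intro ext subset_antisym proj_pt_ccross_subset[OF span] proj_pt_ccross_subset[OF span[symmetric]])
qed

section \<open>Polynomials in the coordinates of the dual planes\<close>

text \<open>
  The variable indexed by \<open>(i, j)\<close> is the coordinate \<open>i\<close> of the \<open>j\<close>-th factor. A polynomial is a
  finitely supported map from monomials to coefficients, a monomial a finitely supported map from
  variables to exponents.
\<close>

type_synonym 'm lpoly = "((3 \<times> 'm) \<Rightarrow>\<^sub>0 nat) \<Rightarrow>\<^sub>0 complex"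

definition lvar :: "3 \<times> 'm \<Rightarrow> 'm lpoly" where
  "lvar x = Poly_Mapping.single (Poly_Mapping.single x 1) 1"

definition lconst :: "complex \<Rightarrow> 'm lpoly" where
  "lconst c = Poly_Mapping.single 0 c"

definition lpoly_eval :: "('m \<Rightarrow> complex ^ 3) \<Rightarrow> 'm lpoly \<Rightarrow> complex" where
  "lpoly_eval v p = (\<Sum>t\<in>Poly_Mapping.keys p. Poly_Mapping.lookup p t *
     (\<Prod>(i, j)\<in>Poly_Mapping.keys t. (v j $ i) ^ Poly_Mapping.lookup t (i, j)))"

definition lpoly_subst :: "(3 \<times> 'm \<Rightarrow> 'm lpoly) \<Rightarrow> 'm lpoly \<Rightarrow> 'm lpoly" where
  "lpoly_subst \<sigma> p = (\<Sum>t\<in>Poly_Mapping.keys p. lconst (Poly_Mapping.lookup p t) *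
     (\<Prod>x\<in>Poly_Mapping.keys t. \<sigma> x ^ Poly_Mapping.lookup t x))"

definition multihomogeneous :: "'m::finite lpoly \<Rightarrow> bool" where
  "multihomogeneous p \<longleftrightarrow> (\<exists>d :: 'm \<Rightarrow> nat. \<forall>t\<in>Poly_Mapping.keys p. \<forall>j.
     (\<Sum>i\<in>UNIV. Poly_Mapping.lookup t (i, j)) = d j)"

section \<open>The line multiview variety and its ideal\<close>

text \<open>
  A polynomial that need not be multihomogeneous vanishes at a point of the product if it vanishes
  on all homogeneous coordinate vectors of that point.
\<close>

definition vanishes_at :: "'m lpoly \<Rightarrow> ('m \<Rightarrow> (complex ^ 3) set) \<Rightarrow> bool" where
  "vanishes_at p x \<longleftrightarrow> (\<forall>v. (\<forall>j. v j \<in> x j \<and> v j \<noteq> 0) \<longrightarrow> lpoly_eval v p = 0)"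

definition zariski_closed :: "('m::finite \<Rightarrow> (complex ^ 3) set) set \<Rightarrow> bool" where
  "zariski_closed Z \<longleftrightarrow> (\<exists>F. (\<forall>p\<in>F. multihomogeneous p) \<and>
     Z = {x \<in> UNIV \<rightarrow> proj_space. \<forall>p\<in>F. vanishes_at p x})"

definition line_multiview_variety ::
    "('m::finite \<Rightarrow> complex ^ 4 ^ 3) \<Rightarrow> ('m \<Rightarrow> (complex ^ 3) set) set" where
  "line_multiview_variety C = zariski_closed hull (joint_camera_map C ` joint_camera_domain C)"

definition vanishing_ideal :: "('m \<Rightarrow> (complex ^ 3) set) set \<Rightarrow> 'm lpoly set" where
  "vanishing_ideal X = {p. \<forall>x\<in>X. vanishes_at p x}"

section \<open>The group action\<close>

text \<open>An element of the projective linear group is the set of its matrix representatives.\<close>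

definition PGL :: "(complex ^ 'n ^ 'n) set set" where
  "PGL = {{map_matrix ((*) c) A | c. c \<noteq> 0} | A. invertible A}"

text \<open>The action on cameras, computed on matrix representatives.\<close>

definition act_arrangement ::
    "complex ^ 4 ^ 4 \<Rightarrow> ('m \<Rightarrow> complex ^ 3 ^ 3) \<Rightarrow> ('m \<Rightarrow> complex ^ 4 ^ 3) \<Rightarrow> 'm \<Rightarrow> complex ^ 4 ^ 3" where
  "act_arrangement H Hs C = (\<lambda>i. Hs i ** C i ** matrix_inv H)"

definition inv_transpose :: "complex ^ 3 ^ 3 \<Rightarrow> complex ^ 3 ^ 3" where
  "inv_transpose A = transpose (matrix_inv A)"

definition L_point :: "('m \<Rightarrow> complex ^ 3 ^ 3) \<Rightarrow> ('m \<Rightarrow> (complex ^ 3) set) \<Rightarrow> 'm \<Rightarrow> (complex ^ 3) set" where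
  "L_point Hs x = (\<lambda>j. (\<lambda>v. inv_transpose (Hs j) *v v) ` x j)"

definition L_ring :: "('m \<Rightarrow> complex ^ 3 ^ 3) \<Rightarrow> 'm lpoly \<Rightarrow> 'm lpoly" where
  "L_ring Hs = lpoly_subst (\<lambda>(i, j). \<Sum>k\<in>UNIV. lconst (inv_transpose (Hs j) $ i $ k) * lvar (k, j))"

end

theory Submission
  imports Defs
begin

text \<open>
  The group acts on everything in sight, and the joint camera map is equivariant. If a line \<open>L\<close> is
  spanned by \<open>a\<close> and \<open>b\<close>, then \<open>H L\<close> is spanned by \<open>H a\<close> and \<open>H b\<close>, and the camera
  \<open>H\<^sub>i C\<^sub>i H\<^sup>-\<^sup>1\<close> maps these two points to \<open>H\<^sub>i C\<^sub>i a\<close> and \<open>H\<^sub>i C\<^sub>i b\<close>. The cross product obeys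
  \<open>(A u) \<times> (A v) = det A \<sqdot> A\<^sup>-\<^sup>T (u \<times> v)\<close> (\<open>ccross_mult\<close>), so up to scale the image line moves by
  the inverse transpose of \<open>H\<^sub>i\<close>; this is \<open>joint_camera_map_act\<close>. As \<open>H\<close> also permutes the lines
  compatibly with the centers (\<open>joint_camera_domain_act\<close>), the image of the new camera map is the
  image of the old one, moved by \<open>L_point\<close>.

  It remains to see that \<open>L_point\<close> commutes with the Zariski closure. The ring map \<open>L_ring\<close> is
  pullback of polynomial functions along \<open>L_point\<close> (\<open>vanishes_at_L_ring\<close>), and being linear in the
  coordinates of each factor it preserves multihomogeneity. Hence preimages of closed
  sets under \<open>L_point\<close> are closed. The inverse of \<open>L_point\<close> has the same form, so \<open>L_point\<close>
  is a homeomorphism (\<open>zariski_hull_L_point\<close>), which gives the equality of varieties. The equality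
  of ideals is the same pullback formula read on the points of the variety.
\<close>

section \<open>Evaluation and substitution of polynomials\<close>

text \<open>
  With finitely many variables, a monomial can be evaluated by a product over all variables, a
  range that does not depend on the monomial. This makes evaluation of monomials visibly
  multiplicative.
\<close>

lemma monomial_value_UNIV:
  fixes t :: "(3 \<times> 'm::finite) \<Rightarrow>\<^sub>0 nat"
  shows "(\<Prod>(i, j)\<in>Poly_Mapping.keys t. (v j $ i) ^ Poly_Mapping.lookup t (i, j)) =
    (\<Prod>x\<in>UNIV. (v (snd x) $ fst x :: complex) ^ Poly_Mapping.lookup t x)"
  by (rule prod.mono_neutral_cong_left) (auto simp: in_keys_iff split_beta)

text \<open>
  Two polynomials can be added under evaluation only over a common range of monomials.
\<close>

lemma lpoly_eval_superset:
  assumes "finite K" "Poly_Mapping.keys p \<subseteq> K"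
  shows "lpoly_eval v p = (\<Sum>t\<in>K. Poly_Mapping.lookup p t *
     (\<Prod>(i, j)\<in>Poly_Mapping.keys t. (v j $ i) ^ Poly_Mapping.lookup t (i, j)))"
  unfolding lpoly_eval_def
  by (rule sum.mono_neutral_left) (use assms in \<open>auto simp: in_keys_iff\<close>)

lemma lpoly_eval_zero [simp]: "lpoly_eval v 0 = 0"
  by (simp add: lpoly_eval_def)

lemma lpoly_eval_add: "lpoly_eval v (p + q) = lpoly_eval v p + lpoly_eval v q"
proof -
  let ?K = "Poly_Mapping.keys p \<union> Poly_Mapping.keys q"
  have "lpoly_eval v r = (\<Sum>t\<in>?K. Poly_Mapping.lookup r t *
     (\<Prod>(i, j)\<in>Poly_Mapping.keys t. (v j $ i) ^ Poly_Mapping.lookup t (i, j)))"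
    if "Poly_Mapping.keys r \<subseteq> ?K" for r
    by (rule lpoly_eval_superset) (use that in auto)
  then show ?thesis
    using Poly_Mapping.keys_add[of p q]
    by (simp add: lookup_add distrib_right sum.distrib)
qed

lemma lpoly_eval_sum: "lpoly_eval v (\<Sum>a\<in>A. f a) = (\<Sum>a\<in>A. lpoly_eval v (f a))"
  by (induction A rule: infinite_finite_induct) (simp_all add: lpoly_eval_add)

lemma lpoly_eval_monomial:
  fixes v :: "'m::finite \<Rightarrow> complex ^ 3"
  shows "lpoly_eval v (Poly_Mapping.single t c) =
    c * (\<Prod>x\<in>UNIV. (v (snd x) $ fst x) ^ Poly_Mapping.lookup t x)"
  by (cases "c = 0") (simp_all add: lpoly_eval_def monomial_value_UNIV)

lemma sum_of_monomials:
  "p = (\<Sum>t\<in>Poly_Mapping.keys p. Poly_Mapping.single t (Poly_Mapping.lookup p t))"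
  by (rule poly_mapping_eqI)
    (auto simp: lookup_sum lookup_single when_def in_keys_iff sum.delta)

text \<open>
  Both factors are expanded into monomials; on a pair of monomials the claim is \<open>power_add\<close>.
\<close>

lemma lpoly_eval_mult:
  fixes v :: "'m::finite \<Rightarrow> complex ^ 3"
  shows "lpoly_eval v (p * q) = lpoly_eval v p * lpoly_eval v q"
proof -
  let ?m = "\<lambda>r t. Poly_Mapping.single t (Poly_Mapping.lookup r t)"
  have monomials: "lpoly_eval v (?m p s * ?m q t) = lpoly_eval v (?m p s) * lpoly_eval v (?m q t)"
    for s t
    by (simp add: mult_single lpoly_eval_monomial lookup_add power_add prod.distrib)
  have "lpoly_eval v (p * q) =
      lpoly_eval v ((\<Sum>s\<in>Poly_Mapping.keys p. ?m p s) * (\<Sum>t\<in>Poly_Mapping.keys q. ?m q t))"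
    by (simp flip: sum_of_monomials)
  also have "\<dots> = lpoly_eval v (\<Sum>s\<in>Poly_Mapping.keys p. ?m p s) *
      lpoly_eval v (\<Sum>t\<in>Poly_Mapping.keys q. ?m q t)"
    by (simp add: sum_product lpoly_eval_sum monomials)
  finally show ?thesis
    by (simp flip: sum_of_monomials)
qed

lemma lpoly_eval_lconst [simp]:
  fixes v :: "'m::finite \<Rightarrow> complex ^ 3"
  shows "lpoly_eval v (lconst c) = c"
  by (simp add: lconst_def lpoly_eval_monomial)

lemma lpoly_eval_lvar [simp]:
  fixes v :: "'m::finite \<Rightarrow> complex ^ 3"
  shows "lpoly_eval v (lvar x) = v (snd x) $ fst x"
  by (simp add: lvar_def lpoly_eval_def split_beta)

lemma lpoly_eval_one [simp]:
  fixes v :: "'m::finite \<Rightarrow> complex ^ 3"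
  shows "lpoly_eval v 1 = 1"
  using lpoly_eval_lconst[of v 1] by (simp add: lconst_def)

lemma lpoly_eval_power:
  fixes v :: "'m::finite \<Rightarrow> complex ^ 3"
  shows "lpoly_eval v (p ^ n) = lpoly_eval v p ^ n"
  by (induction n) (simp_all add: lpoly_eval_mult)

lemma lpoly_eval_prod:
  fixes v :: "'m::finite \<Rightarrow> complex ^ 3"
  shows "lpoly_eval v (\<Prod>a\<in>A. f a) = (\<Prod>a\<in>A. lpoly_eval v (f a))"
  by (induction A rule: infinite_finite_induct) (simp_all add: lpoly_eval_mult)

text \<open>
  Substitution is composition of polynomial functions, because evaluation is a ring homomorphism.
\<close>

lemma lpoly_eval_subst:
  fixes v :: "'m::finite \<Rightarrow> complex ^ 3"
  assumes "\<And>i j. lpoly_eval v (\<sigma> (i, j)) = w j $ i"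
  shows "lpoly_eval v (lpoly_subst \<sigma> p) = lpoly_eval w p"
proof -
  have \<sigma>: "lpoly_eval v (\<sigma> x) = w (snd x) $ fst x" for x
    using assms[of "fst x" "snd x"] by simp
  have "lpoly_eval v (lpoly_subst \<sigma> p) = (\<Sum>t\<in>Poly_Mapping.keys p. Poly_Mapping.lookup p t *
     (\<Prod>x\<in>Poly_Mapping.keys t. lpoly_eval v (\<sigma> x) ^ Poly_Mapping.lookup t x))"
    by (simp add: lpoly_subst_def lpoly_eval_sum lpoly_eval_mult lpoly_eval_prod lpoly_eval_power)
  also have "\<dots> = lpoly_eval w p"
    by (simp add: lpoly_eval_def[of w] split_beta \<sigma>)
  finally show ?thesis .
qed

lemma lpoly_eval_L_ring:
  fixes v :: "'m::finite \<Rightarrow> complex ^ 3"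
  shows "lpoly_eval v (L_ring Hs p) = lpoly_eval (\<lambda>j. inv_transpose (Hs j) *v v j) p"
  unfolding L_ring_def
  by (rule lpoly_eval_subst)
    (simp add: lpoly_eval_sum lpoly_eval_mult matrix_vector_mult_def)

section \<open>Multidegrees\<close>

definition has_multidegree :: "('m \<Rightarrow> nat) \<Rightarrow> 'm lpoly \<Rightarrow> bool" where
  "has_multidegree d p \<longleftrightarrow>
     (\<forall>t\<in>Poly_Mapping.keys p. \<forall>j. (\<Sum>i\<in>UNIV. Poly_Mapping.lookup t (i, j)) = d j)"

lemma multihomogeneous_iff: "multihomogeneous p \<longleftrightarrow> (\<exists>d. has_multidegree d p)"
  by (simp add: multihomogeneous_def has_multidegree_def)

lemma has_multidegree_sum:
  assumes "\<And>a. a \<in> A \<Longrightarrow> has_multidegree d (f a)"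
  shows "has_multidegree d (\<Sum>a\<in>A. f a)"
proof -
  have "Poly_Mapping.keys (\<Sum>a\<in>A. f a) \<subseteq> (\<Union>a\<in>A. Poly_Mapping.keys (f a))"
  proof (induction A rule: infinite_finite_induct)
    case (insert a A)
    then show ?case using Poly_Mapping.keys_add[of "f a" "\<Sum>a\<in>A. f a"] by auto
  qed auto
  then show ?thesis
    using assms unfolding has_multidegree_def by blast
qed

lemma has_multidegree_mult:
  assumes "has_multidegree d p" "has_multidegree e q"
  shows "has_multidegree (\<lambda>j. d j + e j) (p * q)"
  unfolding has_multidegree_def
proof (intro ballI allI)
  fix t j
  assume "t \<in> Poly_Mapping.keys (p * q)"
  then obtain a b where "t = a + b" "a \<in> Poly_Mapping.keys p" "b \<in> Poly_Mapping.keys q"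
    using keys_mult[of p q] by blast
  then show "(\<Sum>i\<in>UNIV. Poly_Mapping.lookup t (i, j)) = d j + e j"
    using assms by (simp add: has_multidegree_def lookup_add sum.distrib)
qed

lemma has_multidegree_lconst: "has_multidegree (\<lambda>_. 0) (lconst c)"
  by (simp add: has_multidegree_def lconst_def)

lemma has_multidegree_lvar: "has_multidegree (\<lambda>j. of_bool (j = l)) (lvar (k, l))"
  by (auto simp: has_multidegree_def lvar_def lookup_single when_def of_bool_def)

lemma has_multidegree_one: "has_multidegree (\<lambda>_. 0) 1"
  using has_multidegree_lconst[of 1] by (simp add: lconst_def)

lemma has_multidegree_power:
  assumes "has_multidegree d p"
  shows "has_multidegree (\<lambda>j. n * d j) (p ^ n)"
proof (induction n)
  case (Suc n)
  show ?case using has_multidegree_mult[OF assms Suc.IH] by simp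
qed (simp add: has_multidegree_one)

lemma has_multidegree_prod:
  assumes "\<And>a. a \<in> A \<Longrightarrow> has_multidegree (d a) (f a)"
  shows "has_multidegree (\<lambda>j. \<Sum>a\<in>A. d a j) (\<Prod>a\<in>A. f a)"
  using assms
proof (induction A rule: infinite_finite_induct)
  case (insert a A)
  then show ?case using has_multidegree_mult[of "d a" "f a" "\<lambda>j. \<Sum>a\<in>A. d a j"] by simp
qed (simp_all add: has_multidegree_one)

text \<open>
  Replacing every variable by a form that is linear in the same factor and free of the others does
  not change the multidegree: each monomial is replaced by a product with as many such
  forms for the factor \<open>j\<close> as the monomial has variables of the factor \<open>j\<close>.
\<close>

lemma has_multidegree_subst:
  fixes p :: "'m::finite lpoly"
  assumes \<sigma>: "\<And>i l. has_multidegree (\<lambda>j. of_bool (j = l)) (\<sigma> (i, l))"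
    and p: "has_multidegree d p"
  shows "has_multidegree d (lpoly_subst \<sigma> p)"
  unfolding lpoly_subst_def
proof (rule has_multidegree_sum)
  fix t assume t: "t \<in> Poly_Mapping.keys p"
  let ?e = "\<lambda>x j. Poly_Mapping.lookup t x * of_bool (j = snd x)"
  have factor: "has_multidegree (?e x) (\<sigma> x ^ Poly_Mapping.lookup t x)" for x
    using has_multidegree_power[OF \<sigma>[of "snd x" "fst x"]] by simp
  have degree: "(\<lambda>j. 0 + (\<Sum>x\<in>Poly_Mapping.keys t. ?e x j)) = d"
  proof
    fix j
    have "(\<Sum>x\<in>Poly_Mapping.keys t. ?e x j) = (\<Sum>x\<in>UNIV. ?e x j)"
      by (rule sum.mono_neutral_left) (auto simp: in_keys_iff)
    \<comment> \<open>Only the three variables of the factor \<open>j\<close> contribute to the degree in that factor.\<close>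
    also have "\<dots> = (\<Sum>x\<in>(\<lambda>i. (i, j)) ` UNIV. ?e x j)"
      by (rule sum.mono_neutral_right) auto
    also have "\<dots> = (\<Sum>i\<in>UNIV. Poly_Mapping.lookup t (i, j))"
      by (subst sum.reindex) (auto simp: inj_on_def)
    also have "\<dots> = d j"
      using p t by (simp add: has_multidegree_def)
    finally show "0 + (\<Sum>x\<in>Poly_Mapping.keys t. ?e x j) = d j" by simp
  qed
  have "has_multidegree (\<lambda>j. \<Sum>x\<in>Poly_Mapping.keys t. ?e x j)
      (\<Prod>x\<in>Poly_Mapping.keys t. \<sigma> x ^ Poly_Mapping.lookup t x)"
    by (rule has_multidegree_prod) (rule factor)
  from has_multidegree_mult[OF has_multidegree_lconst this, of "Poly_Mapping.lookup p t"]
  show "has_multidegree d (lconst (Poly_Mapping.lookup p t) *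
      (\<Prod>x\<in>Poly_Mapping.keys t. \<sigma> x ^ Poly_Mapping.lookup t x))"
    unfolding degree .
qed

lemma multihomogeneous_L_ring:
  fixes p :: "'m::finite lpoly"
  assumes "multihomogeneous p"
  shows "multihomogeneous (L_ring Hs p)"
proof -
  obtain d where d: "has_multidegree d p"
    using assms by (auto simp: multihomogeneous_iff)
  have "has_multidegree (\<lambda>j. of_bool (j = l))
      (\<Sum>k\<in>UNIV. lconst (inv_transpose (Hs l) $ i $ k) * lvar (k, l))" for i l
    by (rule has_multidegree_sum)
      (use has_multidegree_mult[OF has_multidegree_lconst has_multidegree_lvar] in simp)
  then have "has_multidegree d (L_ring Hs p)"
    unfolding L_ring_def by (intro has_multidegree_subst[OF _ d]) simp
  then show ?thesis
    by (auto simp: multihomogeneous_iff)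
qed

section \<open>The action on the product of projective planes\<close>

lemma matrix_inv_left_right:
  fixes A :: "complex ^ 'n ^ 'n"
  assumes "invertible A"
  shows "A ** matrix_inv A = mat 1" "matrix_inv A ** A = mat 1"
  using someI_ex[OF assms[unfolded invertible_def]] by (simp_all add: matrix_inv_def)

lemma invertible_matrix_inv:
  fixes A :: "complex ^ 'n ^ 'n"
  assumes "invertible A"
  shows "invertible (matrix_inv A)"
  using matrix_inv_left_right[OF assms] unfolding invertible_def by blast

lemma invertible_PGL_representative:
  assumes "g \<in> PGL" "A \<in> g"
  shows "invertible (A :: complex ^ 'n ^ 'n)"
proof -
  obtain B c where B: "invertible B" "c \<noteq> 0" "A = map_matrix ((*) c) B"
    using assms by (auto simp: PGL_def)
  have left: "map_matrix ((*) (a::complex)) X ** map_matrix ((*) b) Y = map_matrix ((*) (a * b)) (X ** Y)"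
    for a b and X Y :: "complex ^ 'n ^ 'n"
    by (simp add: map_matrix_def matrix_matrix_mult_def vec_eq_iff sum_distrib_left mult_ac)
  have one: "map_matrix ((*) 1) X = X" for X :: "complex ^ 'n ^ 'n"
    by (simp add: map_matrix_def vec_eq_iff)
  from B(1) obtain B' where "B ** B' = mat 1" "B' ** B = mat 1"
    by (auto simp: invertible_def)
  then have "A ** map_matrix ((*) (inverse c)) B' = mat 1" "map_matrix ((*) (inverse c)) B' ** A = mat 1"
    using B(2) by (simp_all add: B(3) left one)
  then show ?thesis by (auto simp: invertible_def)
qed

lemma inv_transpose_inverse:
  assumes "invertible A"
  shows "inv_transpose A ** transpose A = mat 1" "transpose A ** inv_transpose A = mat 1"
  using matrix_inv_left_right[OF assms]
  by (simp_all add: inv_transpose_def transpose_mat flip: matrix_transpose_mul)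

text \<open>
  The transformation of the dual plane induced by the inverse matrix is the plain transpose. This
  is what makes the inverse of \<open>L_point\<close> again a map of the form \<open>L_point\<close>.
\<close>

lemma inv_transpose_matrix_inv:
  assumes "invertible A"
  shows "inv_transpose (matrix_inv A) = transpose A"
proof -
  let ?B = "matrix_inv A"
  have "inv_transpose ?B = inv_transpose ?B ** (transpose ?B ** transpose A)"
    using matrix_inv_left_right[OF assms] by (simp add: transpose_mat flip: matrix_transpose_mul)
  also have "\<dots> = transpose A"
    using inv_transpose_inverse(1)[OF invertible_matrix_inv[OF assms]]
    by (simp add: matrix_mul_assoc)
  finally show ?thesis .
qed

lemma L_point_inverse:
  assumes "\<And>i. invertible (Hs i)"
  shows "L_point (\<lambda>i. matrix_inv (Hs i)) (L_point Hs x) = x"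
    and "L_point Hs (L_point (\<lambda>i. matrix_inv (Hs i)) x) = x"
  unfolding L_point_def image_image matrix_vector_mul_assoc inv_transpose_matrix_inv[OF assms]
    inv_transpose_inverse[OF assms] matrix_vector_mul_lid
  by simp_all

lemma L_point_proj_space:
  assumes inv: "\<And>i. invertible (Hs i)"
    and x: "x \<in> UNIV \<rightarrow> proj_space"
  shows "L_point Hs x \<in> UNIV \<rightarrow> proj_space"
proof
  fix j
  have "inj ((*v) (inv_transpose (Hs j)))"
    using inv_transpose_inverse(2)[OF inv[of j]] matrix_left_invertible_injective by blast
  then have "inj_on ((*v) (inv_transpose (Hs j))) (vec.span (x j))"
    by (rule inj_on_subset) simp
  moreover have "vec.subspace (x j)" "vec.dim (x j) = 1"
    using x by (auto simp: proj_space_def)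
  ultimately show "L_point Hs x j \<in> proj_space"
    by (simp add: L_point_def proj_space_def vec.subspace_image vec.dim_image_eq
        matrix_vector_mul_linear_gen)
qed

text \<open>
  \<open>L_ring\<close> is the pullback along \<open>L_point\<close>: the homogeneous coordinate vectors of the image point
  are the images of those of the point, and invertibility keeps nonzero vectors nonzero in
  both directions.
\<close>

lemma vanishes_at_L_ring:
  fixes p :: "'m::finite lpoly"
  assumes inv: "\<And>i. invertible (Hs i)"
  shows "vanishes_at (L_ring Hs p) x \<longleftrightarrow> vanishes_at p (L_point Hs x)"
proof -
  let ?T = "\<lambda>j. inv_transpose (Hs j)"
  have T0: "?T j *v v = 0 \<longleftrightarrow> v = 0" for j v
    using inv_transpose_inverse(2)[OF inv[of j]]
    by (metis matrix_vector_mul_assoc matrix_vector_mul_lid matrix_vector_mult_0_right)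
  show ?thesis
  proof
    assume *: "vanishes_at (L_ring Hs p) x"
    show "vanishes_at p (L_point Hs x)"
      unfolding vanishes_at_def
    proof (intro allI impI)
      fix w assume w: "\<forall>j. w j \<in> L_point Hs x j \<and> w j \<noteq> 0"
      then have "\<forall>j. \<exists>u. u \<in> x j \<and> w j = ?T j *v u"
        by (auto simp: L_point_def)
      then obtain v where v: "\<And>j. v j \<in> x j" "\<And>j. w j = ?T j *v v j"
        by metis
      then have "\<forall>j. v j \<in> x j \<and> v j \<noteq> 0"
        using w T0 by metis
      then have "lpoly_eval v (L_ring Hs p) = 0"
        using * by (simp add: vanishes_at_def)
      moreover have "w = (\<lambda>j. ?T j *v v j)"
        using v(2) by blast
      ultimately show "lpoly_eval w p = 0"
        by (simp add: lpoly_eval_L_ring)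
    qed
  next
    assume "vanishes_at p (L_point Hs x)"
    then show "vanishes_at (L_ring Hs p) x"
      by (auto simp: vanishes_at_def lpoly_eval_L_ring L_point_def T0)
  qed
qed

text \<open>
  Pulling back the defining equations of \<open>Z\<close> gives multihomogeneous equations for the preimage.
\<close>

lemma zariski_closed_vimage_L_point:
  assumes inv: "\<And>i. invertible (Hs i)" and Z: "zariski_closed Z"
  shows "zariski_closed (L_point Hs -` Z)"
proof -
  obtain F where F: "\<forall>p\<in>F. multihomogeneous p"
    "Z = {x \<in> UNIV \<rightarrow> proj_space. \<forall>p\<in>F. vanishes_at p x}"
    using Z by (auto simp: zariski_closed_def)
  \<comment> \<open>Needed because \<open>L_point\<close> also acts on tuples of sets that are not points of the product.\<close>
  have proj: "L_point Hs x \<in> UNIV \<rightarrow> proj_space \<longleftrightarrow> x \<in> UNIV \<rightarrow> proj_space" for x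
    using L_point_proj_space[of Hs x, OF inv] L_point_inverse(1)[of Hs x, OF inv]
      L_point_proj_space[of "\<lambda>i. matrix_inv (Hs i)" "L_point Hs x", OF invertible_matrix_inv[OF inv]]
    by auto
  have "L_point Hs -` Z = {x \<in> UNIV \<rightarrow> proj_space. \<forall>p\<in>L_ring Hs ` F. vanishes_at p x}"
    unfolding F(2) by (simp only: vimage_Collect_eq proj ball_simps vanishes_at_L_ring[OF inv])
  moreover have "\<forall>p\<in>L_ring Hs ` F. multihomogeneous p"
    using F(1) by (simp add: multihomogeneous_L_ring)
  ultimately show ?thesis
    unfolding zariski_closed_def by (intro exI[of _ "L_ring Hs ` F"] conjI)
qed

text \<open>
  A bijection under which the distinguished sets correspond also makes the distinguished supersets
  of \<open>X\<close> correspond to those of \<open>f ` X\<close>, hence it maps one hull to the other.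
\<close>

lemma hull_image_bij:
  assumes "bij f" and vimage: "\<And>Z. S Z \<Longrightarrow> S (f -` Z)" and image: "\<And>Z. S Z \<Longrightarrow> S (f ` Z)"
  shows "S hull (f ` X) = f ` (S hull X)"
proof -
  have "f x \<in> S hull (f ` X) \<longleftrightarrow> x \<in> S hull X" for x
  proof
    assume *: "f x \<in> S hull (f ` X)"
    show "x \<in> S hull X"
      unfolding hull_def
    proof clarify
      fix Z assume "S Z" "X \<subseteq> Z"
      then have "S (f ` Z)" "f ` X \<subseteq> f ` Z" using image by auto
      then have "f x \<in> f ` Z" using * hull_minimal by blast
      then show "x \<in> Z" using \<open>bij f\<close> by (auto simp: bij_def inj_def)
    qed
  next
    assume *: "x \<in> S hull X"
    show "f x \<in> S hull (f ` X)"
      unfolding hull_def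
    proof clarify
      fix Z assume "S Z" "f ` X \<subseteq> Z"
      then have "S (f -` Z)" "X \<subseteq> f -` Z" using vimage by auto
      then have "x \<in> f -` Z" using * hull_minimal by blast
      then show "f x \<in> Z" by simp
    qed
  qed
  then show ?thesis
    using \<open>bij f\<close> by (auto simp: image_iff) (metis bij_pointE)
qed

lemma zariski_hull_L_point:
  assumes inv: "\<And>i. invertible (Hs i)"
  shows "zariski_closed hull (L_point Hs ` X) = L_point Hs ` (zariski_closed hull X)"
proof (rule hull_image_bij)
  let ?K = "\<lambda>i. matrix_inv (Hs i)"
  show "bij (L_point Hs)"
    by (rule o_bij[of "L_point ?K"]) (simp_all add: fun_eq_iff L_point_inverse[OF inv])
  show "zariski_closed (L_point Hs -` Z)" if "zariski_closed Z" for Z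
    by (rule zariski_closed_vimage_L_point[OF inv that])
  show "zariski_closed (L_point Hs ` Z)" if "zariski_closed Z" for Z
  proof -
    have "L_point Hs ` Z = L_point ?K -` Z"
    proof (rule set_eqI)
      show "x \<in> L_point Hs ` Z \<longleftrightarrow> x \<in> L_point ?K -` Z" for x
        using L_point_inverse[of Hs x, OF inv] L_point_inverse(1)[of Hs, OF inv] by force
    qed
    then show ?thesis
      using zariski_closed_vimage_L_point[of ?K, OF _ that] inv by (simp add: invertible_matrix_inv)
  qed
qed

section \<open>Equivariance of the joint camera map\<close>

text \<open>
  Pairing \<open>(A a) \<times> (A b)\<close> with \<open>A c\<close> is the determinant of the matrix with columns \<open>A a\<close>, \<open>A b\<close>,
  \<open>A c\<close>, which is \<open>det A\<close> times the determinant for \<open>a\<close>, \<open>b\<close>, \<open>c\<close>. The identity below is this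
  statement for all \<open>c\<close> at once.
\<close>

lemma transpose_mult_ccross:
  "transpose A *v ccross (A *v a) (A *v b) = det A *s ccross a b"
  by (simp add: ccross_def vec_eq_iff forall_3 matrix_vector_mult_def sum_3 det_3 transpose_def
      algebra_simps)

lemma ccross_mult:
  assumes "invertible A"
  shows "ccross (A *v a) (A *v b) = det A *s (inv_transpose A *v ccross a b)"
proof -
  have "ccross (A *v a) (A *v b) = inv_transpose A *v (transpose A *v ccross (A *v a) (A *v b))"
    using inv_transpose_inverse(1)[OF assms] by (simp add: matrix_vector_mul_assoc del: transpose_matrix_vector)
  then show ?thesis
    by (simp only: transpose_mult_ccross vector_scalar_commute)
qed

lemma proj_pt_scale: "c \<noteq> 0 \<Longrightarrow> proj_pt (c *s v) = proj_pt v"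
  using vec.span_image_scale[of "{v}" "\<lambda>_. c"] by (simp add: proj_pt_def)

lemma proj_pt_image: "proj_pt (A *v v) = (*v) A ` proj_pt v"
  for A :: "complex ^ 'n ^ 'k"
  using vec.span_image[of A "{v}"] by (simp add: proj_pt_def)

lemma line_spanned_by_pair:
  assumes "L \<in> lines_P3"
  obtains a b where "L = vec.span {a, b}"
proof -
  obtain B where "B \<subseteq> L" "vec.independent B" "L \<subseteq> vec.span B" "card B = vec.dim L"
    using vec.basis_exists by blast
  then show thesis
    using assms that card_2_iff[of B]
    by (metis (mono_tags, lifting) lines_P3_def mem_Collect_eq subset_antisym vec.span_minimal)
qed

lemma act_arrangement_apply:
  assumes "invertible H"
  shows "act_arrangement H Hs C i *v (H *v x) = Hs i *v (C i *v x)"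
  using matrix_inv_left_right(2)[OF assms]
  by (simp add: act_arrangement_def matrix_vector_mul_assoc flip: matrix_mul_assoc)

text \<open>
  On a spanning pair the matrix \<open>H\<close> cancels inside the camera, and the matrix \<open>Hs i\<close> passes through
  the cross product as its inverse transpose, up to the factor \<open>det (Hs i)\<close>. This factor is nonzero
  and so disappears in the projective plane.
\<close>

lemma joint_camera_map_act:
  assumes H: "invertible H" and Hs: "\<And>i. invertible (Hs i)" and L: "L \<in> lines_P3"
  shows "joint_camera_map (act_arrangement H Hs C) ((*v) H ` L) = L_point Hs (joint_camera_map C L)"
proof -
  obtain a b where L_eq: "L = vec.span {a, b}"
    using line_spanned_by_pair[OF L] .
  have "(*v) H ` L = vec.span {H *v a, H *v b}"
    unfolding L_eq using vec.span_image[of H "{a, b}"] by simp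
  then have "joint_camera_map (act_arrangement H Hs C) ((*v) H ` L) =
      (\<lambda>i. proj_pt (ccross (Hs i *v (C i *v a)) (Hs i *v (C i *v b))))"
    by (simp only: joint_camera_map_eq act_arrangement_apply[OF H])
  also have "\<dots> = L_point Hs (joint_camera_map C L)"
    using Hs by (simp add: joint_camera_map_eq[OF L_eq] L_point_def ccross_mult proj_pt_scale
        proj_pt_image invertible_det_nz)
  finally show ?thesis .
qed

lemma center_act:
  assumes H: "invertible H" and Hs: "\<And>i. invertible (Hs i)"
  shows "center (act_arrangement H Hs C i) = (*v) H ` center (C i)"
proof -
  have Hs0: "Hs i *v y = 0 \<longleftrightarrow> y = 0" for y
    using matrix_inv_left_right(2)[OF Hs[of i]]
    by (metis matrix_vector_mul_assoc matrix_vector_mul_lid matrix_vector_mult_0_right)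
  have surj: "x = H *v (matrix_inv H *v x)" for x
    using matrix_inv_left_right(1)[OF H] by (simp add: matrix_vector_mul_assoc)
  have "H *v y \<in> center (act_arrangement H Hs C i) \<longleftrightarrow> y \<in> center (C i)" for y
    by (simp add: center_def act_arrangement_apply[OF H] Hs0)
  then show ?thesis
    using surj by (auto simp: image_iff) metis
qed

text \<open>
  \<open>H\<close> permutes the lines of space and moves each center to the new one, so it preserves and
  reflects incidence of lines with centers.
\<close>

lemma joint_camera_domain_act:
  assumes H: "invertible H" and Hs: "\<And>i. invertible (Hs i)"
  shows "joint_camera_domain (act_arrangement H Hs C) = (`) ((*v) H) ` joint_camera_domain C"
proof -
  have line: "(*v) A ` L \<in> lines_P3" if "invertible A" "L \<in> lines_P3" for A L
  proof -
    have "inj ((*v) A)"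
      using matrix_inv_left_right(2)[OF that(1)] matrix_left_invertible_injective by blast
    then have "inj_on ((*v) A) (vec.span L)"
      by (rule inj_on_subset) simp
    then show ?thesis
      using that(2) by (simp add: lines_P3_def vec.subspace_image vec.dim_image_eq
          matrix_vector_mul_linear_gen)
  qed
  have cancel: "(*v) H ` (*v) (matrix_inv H) ` L = L" "(*v) (matrix_inv H) ` (*v) H ` L = L" for L
    using matrix_inv_left_right[OF H] by (simp_all add: image_image matrix_vector_mul_assoc)
  have inj: "inj ((*v) H)"
    using matrix_inv_left_right(2)[OF H] matrix_left_invertible_injective by blast
  have lines: "(*v) H ` L \<in> lines_P3 \<longleftrightarrow> L \<in> lines_P3" for L
    using line[OF H] line[OF invertible_matrix_inv[OF H]] cancel(2) by metis
  have "(*v) H ` L \<in> joint_camera_domain (act_arrangement H Hs C) \<longleftrightarrow> L \<in> joint_camera_domain C" for L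
    by (simp add: joint_camera_domain_def lines center_act[OF H Hs] inj_image_subset_iff[OF inj])
  then show ?thesis
    using cancel(1) by (auto simp: image_iff) metis
qed

theorem proposition4p1:
  fixes h :: "(complex ^ 4 ^ 4) set \<times> ('m::finite \<Rightarrow> (complex ^ 3 ^ 3) set)"
    and H :: "complex ^ 4 ^ 4" and Hs :: "'m \<Rightarrow> complex ^ 3 ^ 3"
    and C :: "'m \<Rightarrow> complex ^ 4 ^ 3"
  assumes "h \<in> PGL \<times> (UNIV \<rightarrow> PGL)"
    and "H \<in> fst h" and "\<And>i. Hs i \<in> snd h i"
    and "camera_arrangement C"
  shows "line_multiview_variety (act_arrangement H Hs C) = L_point Hs ` line_multiview_variety C \<and>
    vanishing_ideal (line_multiview_variety (act_arrangement H Hs C)) =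
      L_ring Hs -` vanishing_ideal (line_multiview_variety C)"
proof -
  have H: "invertible H"
    using assms(1,2) invertible_PGL_representative by auto
  have Hs: "invertible (Hs i)" for i
    using assms(1) invertible_PGL_representative[OF _ assms(3)] by (auto simp: Pi_iff)
  have "joint_camera_map (act_arrangement H Hs C) ` joint_camera_domain (act_arrangement H Hs C) =
      L_point Hs ` joint_camera_map C ` joint_camera_domain C"
    unfolding joint_camera_domain_act[OF H Hs] image_image
    by (rule image_cong) (auto simp: joint_camera_domain_def joint_camera_map_act[OF H Hs])
  then have variety:
    "line_multiview_variety (act_arrangement H Hs C) = L_point Hs ` line_multiview_variety C"
    unfolding line_multiview_variety_def by (simp add: zariski_hull_L_point[OF Hs])
  then show ?thesis
    by (auto simp: vanishing_ideal_def vanishes_at_L_ring[OF Hs])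
qed

end
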